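(* Let $S_n=(E_{n-m},K_m)$ be a split graph with a given semi-transitive orientation, and let $x\in E_{n-m}$ be a vertex of type A (respectively, of type B). Then replacing $x$ by a vertex of type B (respectively, of type A) with the same neighbourhood, i.e. reversing the direction of all edges incident to $x$ and leaving all other edges unchanged, results again in a semi-transitive orientation of $S_n$.
   Context: All graphs are finite and simple. $S_n=(E_{n-m},K_m)$ denotes a graph on $n$ vertices whose vertex set is partitioned into a clique $K_m$ on $m$ vertices and an independent set $E_{n-m}$ on $n-m$ vertices, where the clique $K_m$ is maximal, i.e. every vertex of $E_{n-m}$ has degree at most $m-1$. An orientation is transitive if the presence of edges $u\to v$ and $v\to z$ implies the presence of the edge $u\to z$. A shortcut is an acyclic, non-transitively oriented graph obtained from a directed cycle on at least four vertices by reversing the orientation of one edge and possibly adding more directed edges between its vertices; equivalently, an acyclic, non-transitive oriented graph on vertices $v_0,\ldots,v_k$, $k\ge 3$, containing the directed path $v_0\to v_1\to\cdots\to v_k$ and the edge $v_0\to v_k$. An orientation of a graph is semi-transitive if it is acyclic (no directed cycles) and no induced subgraph is a shortcut. A semi-transitive orientation of $S_n$ induces a transitive orientation on $K_m$; let $\vec{P}=p_1\to p_2\to\cdots\to p_m$ be the directed Hamiltonian path of $K_m$ (so $p_i\to p_j$ exactly when $i<j$). A vertex $x\in E_{n-m}$ is of type A if its neighbourhood is a set of consecutive vertices of $\vec{P}$ and all edges at $x$ are directed away from $x$; it is of type B if its neighbourhood is a set of consecutive vertices of $\vec{P}$ and all edges at $x$ are directed towards $x$. *)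

theory Defs
  imports Main "HOL-Library.Sublist"
begin

text \<open>A graph is given by its vertex set and its symmetric adjacency relation, so the
  neighbourhood of \<open>v\<close> is \<open>E `` {v}\<close>.\<close>

definition simple_graph :: "'a set \<Rightarrow> 'a rel \<Rightarrow> bool" where
  "simple_graph V E \<longleftrightarrow> finite V \<and> E \<subseteq> V \<times> V \<and> sym E \<and> irrefl E"

definition clique :: "'a rel \<Rightarrow> 'a set \<Rightarrow> bool" where
  "clique E K \<longleftrightarrow> (\<forall>u\<in>K. \<forall>v\<in>K. u \<noteq> v \<longrightarrow> (u, v) \<in> E)"

definition independent_set :: "'a rel \<Rightarrow> 'a set \<Rightarrow> bool" where
  "independent_set E I \<longleftrightarrow> (\<forall>u\<in>I. \<forall>v\<in>I. (u, v) \<notin> E)"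

text \<open>\<open>I\<close> and \<open>K\<close> are the vertex sets of $E_{n-m}$ and $K_m$, with \<open>n = card V\<close> and
  \<open>m = card K\<close>. The degree bound is strict instead of \<open>\<le> card K - 1\<close> because subtraction
  on \<open>nat\<close> truncates.\<close>

definition split_graph :: "'a set \<Rightarrow> 'a rel \<Rightarrow> 'a set \<Rightarrow> 'a set \<Rightarrow> bool" where
  "split_graph V E I K \<longleftrightarrow>
     simple_graph V E \<and> I \<union> K = V \<and> I \<inter> K = {} \<and>
     independent_set E I \<and> clique E K \<and>
     (\<forall>v\<in>I. card (E `` {v}) < card K)"

definition orientation :: "'a rel \<Rightarrow> 'a rel \<Rightarrow> bool" where
  "orientation E D \<longleftrightarrow> D \<union> D\<inverse> = E \<and> D \<inter> D\<inverse> = {}"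

definition directed_path :: "'a rel \<Rightarrow> 'a list \<Rightarrow> bool" where
  "directed_path D vs \<longleftrightarrow> distinct vs \<and> successively (\<lambda>u v. (u, v) \<in> D) vs"

text \<open>The list \<open>vs\<close> is $v_0, \ldots, v_k$ with $k \ge 3$.\<close>

definition shortcut :: "'a set \<Rightarrow> 'a rel \<Rightarrow> bool" where
  "shortcut W D \<longleftrightarrow>
     D \<subseteq> W \<times> W \<and> acyclic D \<and> \<not> trans D \<and>
     (\<exists>vs. set vs = W \<and> length vs \<ge> 4 \<and> directed_path D vs \<and> (hd vs, last vs) \<in> D)"

definition induced_arcs :: "'a rel \<Rightarrow> 'a set \<Rightarrow> 'a rel" where
  "induced_arcs D W = D \<inter> W \<times> W"

definition semi_transitive_orientation :: "'a set \<Rightarrow> 'a rel \<Rightarrow> 'a rel \<Rightarrow> bool" where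
  "semi_transitive_orientation V E D \<longleftrightarrow>
     orientation E D \<and> acyclic D \<and> (\<forall>W\<subseteq>V. \<not> shortcut W (induced_arcs D W))"

definition hamiltonian_path_of :: "'a set \<Rightarrow> 'a rel \<Rightarrow> 'a list \<Rightarrow> bool" where
  "hamiltonian_path_of K D ps \<longleftrightarrow> set ps = K \<and> directed_path D ps"

text \<open>The empty set counts as consecutive, so an isolated vertex is of both types.\<close>

definition consecutive_in :: "'a list \<Rightarrow> 'a set \<Rightarrow> bool" where
  "consecutive_in ps N \<longleftrightarrow> (\<exists>ns. sublist ns ps \<and> N = set ns)"

definition type_A :: "'a rel \<Rightarrow> 'a rel \<Rightarrow> 'a list \<Rightarrow> 'a \<Rightarrow> bool" where
  "type_A E D ps x \<longleftrightarrow> consecutive_in ps (E `` {x}) \<and> (\<forall>v\<in>E `` {x}. (x, v) \<in> D)"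

definition type_B :: "'a rel \<Rightarrow> 'a rel \<Rightarrow> 'a list \<Rightarrow> 'a \<Rightarrow> bool" where
  "type_B E D ps x \<longleftrightarrow> consecutive_in ps (E `` {x}) \<and> (\<forall>v\<in>E `` {x}. (v, x) \<in> D)"

definition reverse_at :: "'a \<Rightarrow> 'a rel \<Rightarrow> 'a rel" where
  "reverse_at x D = {(u, v). if u = x \<or> v = x then (v, u) \<in> D else (u, v) \<in> D}"

end

theory Submission imports Defs begin

text \<open>Let \<open>x\<close> be a source. After the reversal \<open>x\<close> is a sink, so a shortcut through \<open>x\<close> has the form
  $v_0 \to \cdots \to v_{k-1} \to x$ with $v_0 \to x$. In the original orientation the same vertices
  carry the path $x \to v_0 \to \cdots \to v_{k-1}$ and the arc $x \to v_{k-1}$; as they do not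
  induce a shortcut there, they induce a transitive tournament with source \<open>x\<close>. Moving \<open>x\<close>
  from the first to the last place keeps it transitive, a contradiction. Sinks are handled by
  reversing all arcs.\<close>

lemma directed_path_converse: "directed_path (D\<inverse>) vs \<longleftrightarrow> directed_path D (rev vs)"
  by (simp add: directed_path_def)

text \<open>Reading the path backwards exchanges its ends, so the reversed closing arc again leads
  from the first vertex to the last.\<close>

lemma shortcut_converse:
  assumes "shortcut W D"
  shows "shortcut W (D\<inverse>)"
proof -
  obtain vs where vs: "set vs = W" "length vs \<ge> 4" "directed_path D vs" "(hd vs, last vs) \<in> D"
    using assms by (auto simp: shortcut_def)
  have "set (rev vs) = W \<and> length (rev vs) \<ge> 4 \<and> directed_path (D\<inverse>) (rev vs)
      \<and> (hd (rev vs), last (rev vs)) \<in> D\<inverse>"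
    using vs by (simp add: directed_path_converse hd_rev last_rev)
  moreover have "D\<inverse> \<subseteq> W \<times> W" "acyclic (D\<inverse>)" "\<not> trans (D\<inverse>)"
    using assms by (auto simp: shortcut_def)
  ultimately show ?thesis
    unfolding shortcut_def by blast
qed

lemma induced_arcs_converse: "induced_arcs (D\<inverse>) W = (induced_arcs D W)\<inverse>"
  by (auto simp: induced_arcs_def)

text \<open>Taking the converse is an involution, so a shortcut induced by the converse of
  \<open>D\<close> would turn back into one induced by \<open>D\<close>.\<close>

lemma semi_transitive_orientation_converse:
  assumes "semi_transitive_orientation V E D"
  shows "semi_transitive_orientation V E (D\<inverse>)"
proof -
  have "\<not> shortcut W (induced_arcs (D\<inverse>) W)" if "W \<subseteq> V" for W
    using assms that shortcut_converse[of W "(induced_arcs D W)\<inverse>"]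
    by (auto simp: semi_transitive_orientation_def induced_arcs_converse)
  then show ?thesis
    using assms by (auto simp: semi_transitive_orientation_def orientation_def)
qed

lemma reverse_at_converse: "reverse_at x (D\<inverse>) = (reverse_at x D)\<inverse>"
  by (auto simp: reverse_at_def)

lemma orientation_reverse_at:
  assumes "orientation E D"
  shows "orientation E (reverse_at x D)"
proof -
  have "reverse_at x D \<union> (reverse_at x D)\<inverse> = D \<union> D\<inverse>"
    by (auto simp: reverse_at_def)
  moreover have "reverse_at x D \<inter> (reverse_at x D)\<inverse> = {}"
    using assms by (auto simp: reverse_at_def orientation_def)
  ultimately show ?thesis
    using assms by (simp add: orientation_def)
qed

lemma acyclic_reverse_at_source:
  assumes "acyclic D" and source: "\<And>v. (v, x) \<notin> D"
  shows "acyclic (reverse_at x D)"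
proof (rule acyclicI, intro allI notI)
  fix a
  assume cycle: "(a, a) \<in> (reverse_at x D)\<^sup>+"
  have sink: "(x, v) \<notin> reverse_at x D" for v
    using source by (simp add: reverse_at_def)
  \<comment> \<open>A walk can meet the sink \<open>x\<close> only at its end; a walk ending
    elsewhere therefore uses unchanged arcs of \<open>D\<close>.\<close>
  have "b = x \<or> (a, b) \<in> D\<^sup>+" if "(a, b) \<in> (reverse_at x D)\<^sup>+" for b
    using that
  proof (induction rule: trancl_induct)
    case (base y)
    then show ?case using sink by (auto simp: reverse_at_def split: if_splits)
  next
    case (step y z)
    then show ?case using sink
      by (auto simp: reverse_at_def split: if_splits intro: trancl_into_trancl)
  qed
  moreover have "a \<noteq> x"
    using tranclD[OF cycle] sink by blast
  ultimately show False
    using cycle \<open>acyclic D\<close> by (auto simp: acyclic_def)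
qed

text \<open>Shortcuts are pulled back on the same vertex set \<open>W\<close>, so their absence
  passes from \<open>D\<close> to the reversed orientation.\<close>

lemma shortcut_reverse_at_source:
  assumes "acyclic D" and source: "\<And>v. (v, x) \<notin> D"
    and short: "shortcut W (induced_arcs (reverse_at x D) W)"
  shows "shortcut W (induced_arcs D W)"
proof (cases "x \<in> W")
  case False
  then have "induced_arcs (reverse_at x D) W = induced_arcs D W"
    by (auto simp: induced_arcs_def reverse_at_def)
  with short show ?thesis by simp
next
  case True
  let ?D = "induced_arcs D W" and ?R = "induced_arcs (reverse_at x D) W"
  have sink: "(x, v) \<notin> ?R" for v
    using source by (simp add: reverse_at_def induced_arcs_def)
  have at_x: "(v, x) \<in> ?R \<longleftrightarrow> (x, v) \<in> ?D" for v
    by (auto simp: reverse_at_def induced_arcs_def)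
  have off_x: "(u, v) \<in> ?R \<longleftrightarrow> (u, v) \<in> ?D" if "u \<noteq> x" "v \<noteq> x" for u v
    using that by (auto simp: reverse_at_def induced_arcs_def)
  obtain vs where vs: "set vs = W" "length vs \<ge> 4" "directed_path ?R vs" "(hd vs, last vs) \<in> ?R"
    using short by (auto simp: shortcut_def)
  obtain us ws where "vs = us @ x # ws"
    using True vs(1) by (metis split_list)
  \<comment> \<open>A successor of \<open>x\<close> on the path would give an arc out of the
    sink.\<close>
  moreover have "ws = []"
    using vs(3) sink calculation
    by (cases ws) (auto simp: directed_path_def successively_append_iff)
  ultimately have us: "vs = us @ [x]" by simp
  have ne: "us \<noteq> []" using vs(2) us by auto
  have x_notin: "x \<notin> set us" and "distinct us"
    using vs(3) us by (auto simp: directed_path_def)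
  \<comment> \<open>The two arcs at \<open>x\<close> swap roles: the last path arc turns into the
    closing arc of \<open>x # us\<close>, and the old closing arc will supply its first path
    arc.\<close>
  have "successively (\<lambda>u v. (u, v) \<in> ?R) us" and last: "(x, last us) \<in> ?D"
    using vs(3) us ne by (auto simp: directed_path_def successively_append_iff at_x)
  then have "successively (\<lambda>u v. (u, v) \<in> ?D) us"
    by (metis (mono_tags, lifting) successively_cong off_x x_notin)
  moreover have "(x, hd us) \<in> ?D"
    using vs(4) us ne by (simp add: at_x)
  ultimately have path: "successively (\<lambda>u v. (u, v) \<in> ?D) (x # us)"
    by (simp add: successively_Cons)
  have "\<not> trans ?D"
  proof
    assume trans: "trans ?D"
    then have "transp (\<lambda>u v. (u, v) \<in> ?D)"
      by (simp add: trans_def transp_def)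
    with path have "sorted_wrt (\<lambda>u v. (u, v) \<in> ?D) (x # us)"
      by (simp add: successively_conv_sorted_wrt)
    \<comment> \<open>Hence in \<open>?R\<close> every other vertex of \<open>W\<close> points to
      \<open>x\<close>, which settles transitivity for triples ending in \<open>x\<close>.\<close>
    then have to_all: "(x, v) \<in> ?D" if "v \<in> W" "v \<noteq> x" for v
      using that vs(1) us by auto
    have "trans ?R"
    proof (rule transI)
      fix a b c
      assume ab: "(a, b) \<in> ?R" and bc: "(b, c) \<in> ?R"
      \<comment> \<open>Both vertices have outgoing arcs in \<open>?R\<close>, so neither is the
        sink; only \<open>c\<close> can be \<open>x\<close>.\<close>
      have ab_off: "a \<noteq> x" "b \<noteq> x" and "a \<in> W"
        using ab bc sink by (auto simp: induced_arcs_def)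
      show "(a, c) \<in> ?R"
      proof (cases "c = x")
        case True
        then show ?thesis
          using to_all[OF \<open>a \<in> W\<close> \<open>a \<noteq> x\<close>] at_x by blast
      next
        case False
        then have "(a, b) \<in> ?D" "(b, c) \<in> ?D"
          using ab bc ab_off off_x by blast+
        then show ?thesis
          using transD[OF trans] off_x[OF ab_off(1) False] by blast
      qed
    qed
    then show False
      using short by (simp add: shortcut_def)
  qed
  moreover have "acyclic ?D"
    using \<open>acyclic D\<close> by (rule acyclic_subset) (auto simp: induced_arcs_def)
  moreover have "set (x # us) = W" "length (x # us) \<ge> 4"
    using vs us by auto
  moreover have "directed_path ?D (x # us)"
    using path x_notin \<open>distinct us\<close> by (simp add: directed_path_def)
  moreover have "(hd (x # us), last (x # us)) \<in> ?D"
    using last ne by simp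
  moreover have "?D \<subseteq> W \<times> W"
    by (auto simp: induced_arcs_def)
  ultimately show ?thesis
    unfolding shortcut_def by blast
qed

lemma semi_transitive_orientation_reverse_at_source:
  assumes "semi_transitive_orientation V E D" and "\<And>v. (v, x) \<notin> D"
  shows "semi_transitive_orientation V E (reverse_at x D)"
  using assms orientation_reverse_at[of E D x] acyclic_reverse_at_source[of D x]
    shortcut_reverse_at_source[of D x]
  unfolding semi_transitive_orientation_def by blast

text \<open>A sink of \<open>D\<close> is a source of the converse, and \<open>reverse_at\<close>
  commutes with taking converses, so the source case applies and its result is converted
  back.\<close>

lemma semi_transitive_orientation_reverse_at_sink:
  assumes "semi_transitive_orientation V E D" and "\<And>v. (x, v) \<notin> D"
  shows "semi_transitive_orientation V E (reverse_at x D)"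
proof -
  have "semi_transitive_orientation V E (reverse_at x (D\<inverse>))"
    using assms by (intro semi_transitive_orientation_reverse_at_source
        semi_transitive_orientation_converse) auto
  then show ?thesis
    using semi_transitive_orientation_converse[of V E "(reverse_at x D)\<inverse>"]
    by (simp add: reverse_at_converse)
qed

theorem theorem21:
  fixes V I K :: "'a set" and E D :: "'a rel" and ps :: "'a list" and x :: 'a
  assumes "split_graph V E I K"
    and "semi_transitive_orientation V E D"
    and "hamiltonian_path_of K D ps"
    and "x \<in> I"
  shows "(type_A E D ps x \<longrightarrow>
            semi_transitive_orientation V E (reverse_at x D) \<and>
            type_B E (reverse_at x D) ps x)
       \<and> (type_B E D ps x \<longrightarrow>
            semi_transitive_orientation V E (reverse_at x D) \<and>
            type_A E (reverse_at x D) ps x)"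
proof -
  have E: "E = D \<union> D\<inverse>" and antisym: "\<And>u v. (u, v) \<in> D \<Longrightarrow> (v, u) \<notin> D"
    using assms(2) by (auto simp: semi_transitive_orientation_def orientation_def)
  have "semi_transitive_orientation V E (reverse_at x D)" if "type_A E D ps x"
    using assms(2)
  proof (rule semi_transitive_orientation_reverse_at_source)
    \<comment> \<open>The tail of an arc into \<open>x\<close> would be a neighbour, and type A
      would provide the opposite arc as well.\<close>
    show "(v, x) \<notin> D" for v
      using that antisym[of v x] by (auto simp: type_A_def E)
  qed
  moreover have "semi_transitive_orientation V E (reverse_at x D)" if "type_B E D ps x"
    using assms(2)
  proof (rule semi_transitive_orientation_reverse_at_sink)
    show "(x, v) \<notin> D" for v
      using that antisym[of x v] by (auto simp: type_B_def E)
  qed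
  \<comment> \<open>\<open>E\<close> and \<open>ps\<close> are unchanged, so the neighbourhood
    remains consecutive and only the arc directions switch.\<close>
  moreover have "type_B E (reverse_at x D) ps x" if "type_A E D ps x"
    using that by (simp add: type_A_def type_B_def reverse_at_def)
  moreover have "type_A E (reverse_at x D) ps x" if "type_B E D ps x"
    using that by (simp add: type_A_def type_B_def reverse_at_def)
  ultimately show ?thesis
    by blast
qed

end
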